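(* Let $s,t$ be non-negative integers, $|x|<1$, $|y|<1$, $x\ne y$, and $\min\{\Re(b),\Re(d)\}\ge0$. Then $$ \begin{aligned} \mathbf{F}_{1}^{(\kappa_l)}(1,s+1,t+1;2;x,y;b,d)&=y^{s+1}\sum_{j=0}^{t-1}\binom{j+s}{s}\frac{(-x)^j}{(y-x)^{j+s+1}}\,{}_{2}F_{1}^{(\kappa_l)}\left[\begin{array}{c}t-j+1,1\\2\end{array};y;b,d\right]\\ &\quad+x^{t+1}\sum_{k=0}^{s-1}\binom{k+t}{t}\frac{(-y)^k}{(x-y)^{k+t+1}}\,{}_{2}F_{1}^{(\kappa_l)}\left[\begin{array}{c}s-k+1,1\\2\end{array};x;b,d\right]\\ &\quad+\binom{t+s}{s}\frac{(-1)^tx^ty^s}{(y-x)^{t+s+1}}\left\{y\,{}_{2}F_{1}^{(\kappa_l)}\left[\begin{array}{c}1,1\\2\end{array};y;b,d\right]-x\,{}_{2}F_{1}^{(\kappa_l)}\left[\begin{array}{c}1,1\\2\end{array};x;b,d\right]\right\}. \end{aligned} $$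
   Context: Here $(a)_m=\Gamma(a+m)/\Gamma(a)$ is the Pochhammer symbol and $B(\cdot,\cdot)$ is Euler's beta function; empty sums are zero. Let $\{\kappa_l\}_{l\ge0}$ be a complex sequence with $\kappa_0=1$ and let $\Theta(z)=\Theta(\kappa_l;z)$ be a function analytic in a disk $|z|<R$ ($0<R<\infty$) with $\Theta(z)=\sum_{l\ge0}\kappa_l z^l/l!$ there, continued analytically to the half-plane $\Re(z)>0$ with $\Theta(z)=M_0z^{\omega}e^{z}[1+O(1/z)]$ as $\Re(z)\to\infty$ ($M_0>0$, $\omega\in\mathbb{C}$). It is also understood that $\Theta$ is defined and continuous on $\Re(z)\le 0$ and that the following integrals converge absolutely. For $\Re(b),\Re(d)\ge0$ and $\Re(\alpha),\Re(\beta)>0$, $$\mathcal{B}^{(\kappa_l)}_{b,d}(\alpha,\beta)=\int_0^1t^{\alpha-1}(1-t)^{\beta-1}\Theta\left(-\frac bt-\frac d{1-t}\right)dt .$$ The extended Gauss hypergeometric function is, for $|z|<1$ and $\Re(\beta_1)>\Re(\alpha_2)>0$, $${}_{2}F_{1}^{(\kappa_l)}\left[\begin{array}{c}\alpha_1,\alpha_2\\ \beta_1\end{array};z;b,d\right]=\sum_{n=0}^\infty(\alpha_1)_n\frac{\mathcal{B}^{(\kappa_l)}_{b,d}(\alpha_2+n,\beta_1-\alpha_2)}{B(\alpha_2,\beta_1-\alpha_2)}\frac{z^n}{n!}.$$ The extended Appell function $\mathbf{F}_1^{(\kappa_l)}$ is, for $\max\{|x|,|y|\}<1$ and $\Re(\gamma_1)>\Re(\alpha)>0$,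 $$\mathbf{F}_{1}^{(\kappa_l)}(\alpha,\beta_1,\beta_2;\gamma_1;x,y;b,d)=\sum_{m,n=0}^\infty(\beta_1)_m(\beta_2)_n\frac{\mathcal{B}^{(\kappa_l)}_{b,d}(\alpha+m+n,\gamma_1-\alpha)}{B(\alpha,\gamma_1-\alpha)}\frac{x^my^n}{m!\,n!}.$$ *)

theory Defs
  imports "HOL-Complex_Analysis.Complex_Analysis" "HOL-Library.Landau_Symbols"
begin

text \<open>
  The integrand is only integrated over the open interval, so that the junk value of
  division by \<open>0\<close> at the endpoints plays no role.  For \<open>0 < t < 1\<close> the base of each
  power is a positive real, so \<open>powr\<close> is unambiguous.
\<close>

definition ext_beta_integrand ::
  "(complex \<Rightarrow> complex) \<Rightarrow> complex \<Rightarrow> complex \<Rightarrow> complex \<Rightarrow> complex \<Rightarrow> real \<Rightarrow> complex" where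
  "ext_beta_integrand \<Theta> b d \<alpha> \<beta> t =
     of_real t powr (\<alpha> - 1) * of_real (1 - t) powr (\<beta> - 1)
       * \<Theta> (- (b / of_real t) - d / of_real (1 - t))"

definition ext_beta ::
  "(complex \<Rightarrow> complex) \<Rightarrow> complex \<Rightarrow> complex \<Rightarrow> complex \<Rightarrow> complex \<Rightarrow> complex" where
  "ext_beta \<Theta> b d \<alpha> \<beta> = (LINT t:{0<..<1}|lborel. ext_beta_integrand \<Theta> b d \<alpha> \<beta> t)"

text \<open>
  \<open>\<Theta>\<close> is a single function on the whole plane: analytic on the union of the disk and the
  right half-plane (the analytic continuation), and merely continuous on the closed left
  half-plane, where \<open>ext_beta\<close> evaluates it.  The sequence \<open>\<kappa>\<close> determines \<open>\<Theta>\<close> near \<open>0\<close> but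
  not on the whole left half-plane, so the extended functions take \<open>\<Theta>\<close> as their argument.
  The power of \<open>z\<close> in the asymptotics is the principal one, and the filter expresses that
  the real part tends to infinity with no restriction on the imaginary part.
  Bochner integrability is absolute convergence.
\<close>

locale ext_kernel =
  fixes \<kappa> :: "nat \<Rightarrow> complex" and R :: real and \<Theta> :: "complex \<Rightarrow> complex"
    and M\<^sub>0 :: real and \<omega> :: complex
  assumes kappa_0: "\<kappa> 0 = 1"
    and R_pos: "0 < R"
    and series: "\<And>z. norm z < R \<Longrightarrow> (\<lambda>l. \<kappa> l * z ^ l / fact l) sums \<Theta> z"
    and holomorphic: "\<Theta> holomorphic_on (ball 0 R \<union> {z. Re z > 0})"
    and M0_pos: "0 < M\<^sub>0"
    and asymptotics:
      "(\<lambda>z. \<Theta> z / (of_real M\<^sub>0 * z powr \<omega> * exp z) - 1)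
         \<in> O[filtercomap Re at_top](\<lambda>z. 1 / z)"
    and continuous: "continuous_on {z. Re z \<le> 0} \<Theta>"
    and integrable:
      "\<And>b d \<alpha> \<beta>. \<lbrakk>Re b \<ge> 0; Re d \<ge> 0; Re \<alpha> > 0; Re \<beta> > 0\<rbrakk> \<Longrightarrow>
         set_integrable lborel {0<..<1} (ext_beta_integrand \<Theta> b d \<alpha> \<beta>)"

definition ext_2F1 ::
  "(complex \<Rightarrow> complex) \<Rightarrow> complex \<Rightarrow> complex \<Rightarrow> complex \<Rightarrow> complex \<Rightarrow> complex \<Rightarrow> complex
    \<Rightarrow> complex" where
  "ext_2F1 \<Theta> \<alpha>\<^sub>1 \<alpha>\<^sub>2 \<beta>\<^sub>1 z b d =
     (\<Sum>n. pochhammer \<alpha>\<^sub>1 n * (ext_beta \<Theta> b d (\<alpha>\<^sub>2 + of_nat n) (\<beta>\<^sub>1 - \<alpha>\<^sub>2) / Beta \<alpha>\<^sub>2 (\<beta>\<^sub>1 - \<alpha>\<^sub>2))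
            * (z ^ n / fact n))"

definition ext_F1 ::
  "(complex \<Rightarrow> complex) \<Rightarrow> complex \<Rightarrow> complex \<Rightarrow> complex \<Rightarrow> complex \<Rightarrow> complex \<Rightarrow> complex
    \<Rightarrow> complex \<Rightarrow> complex \<Rightarrow> complex" where
  "ext_F1 \<Theta> \<alpha> \<beta>\<^sub>1 \<beta>\<^sub>2 \<gamma>\<^sub>1 x y b d =
     (\<Sum>\<^sub>\<infinity>(m, n) \<in> (UNIV :: (nat \<times> nat) set).
        pochhammer \<beta>\<^sub>1 m * pochhammer \<beta>\<^sub>2 n
          * (ext_beta \<Theta> b d (\<alpha> + of_nat m + of_nat n) (\<gamma>\<^sub>1 - \<alpha>) / Beta \<alpha> (\<gamma>\<^sub>1 - \<alpha>))
          * (x ^ m * y ^ n / (fact m * fact n)))"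

end

theory Submission
  imports Defs
begin

text \<open>
  For \<open>\<alpha> = 1\<close> and \<open>\<gamma>\<^sub>1 = 2\<close> all the series involved are weighted by the moments
  \<open>\<mu> N = ext_beta \<Theta> b d (1 + N) 1\<close>, which are bounded.  Hence \<open>F \<mapsto> (\<Sum>N. \<mu> N * F $ N)\<close> is
  a linear functional on power series with absolutely summable coefficients; it sends
  \<open>(1 - x X)\<^sup>-\<^sup>s\<^sup>-\<^sup>1 (1 - y X)\<^sup>-\<^sup>t\<^sup>-\<^sup>1\<close> to the Appell function
  and \<open>(1 - x X)\<^sup>-\<^sup>m\<^sup>-\<^sup>1\<close> to the Gauss function with first parameter \<open>m + 1\<close>.  The theorem
  is the image of the partial fraction decomposition of the former series.
\<close>

unbundle no vec_syntax

text \<open>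
  Repeatedly replacing a factor \<open>X * Y\<close> by \<open>A * Y + B * X\<close> reduces every monomial to pure
  powers of \<open>X\<close> or \<open>Y\<close>; the following is the part in \<open>Y\<close>.  The truncated subtraction in
  \<open>j + a - 1\<close> yields the right value for \<open>a = 0\<close>, namely \<open>Y ^ b\<close>.
\<close>

definition pfd_part :: "'a::comm_ring_1 \<Rightarrow> 'a \<Rightarrow> 'a \<Rightarrow> nat \<Rightarrow> nat \<Rightarrow> 'a" where
  "pfd_part A B Y a b = (\<Sum>j<b. of_nat ((j + a - 1) choose j) * (A ^ a * B ^ j * Y ^ (b - j)))"

lemma pfd_part_0_right [simp]: "pfd_part A B Y a 0 = 0"
  by (simp add: pfd_part_def)

lemma pfd_part_0_left: "b > 0 \<Longrightarrow> pfd_part A B Y 0 b = Y ^ b"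
proof -
  assume "b > 0"
  then obtain b' where b: "b = Suc b'" by (cases b) auto
  have "(\<Sum>j<b'. of_nat ((Suc j - 1) choose Suc j) * (A ^ 0 * B ^ Suc j * Y ^ (Suc b' - Suc j))) = 0"
    by (intro sum.neutral) (simp add: binomial_eq_0)
  thus ?thesis
    unfolding pfd_part_def b by (subst sum.lessThan_Suc_shift) simp
qed

text \<open>One replacement of \<open>X * Y\<close>, seen on the powers of \<open>Y\<close>.
  Pascal's rule splits each coefficient; the term j = 0 joins the first halves to give the
  \<open>A\<close> summand, and the second halves, shifted by one, give the \<open>B\<close>
  summand.\<close>

lemma pfd_part_Suc_Suc:
  "pfd_part A B Y (Suc a) (Suc b) = A * pfd_part A B Y a (Suc b) + B * pfd_part A B Y (Suc a) b"
proof -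
  have pascal: "(Suc j + a) choose Suc j = ((Suc j + a - 1) choose Suc j) + ((j + a) choose j)" for j
    by simp
  have "pfd_part A B Y (Suc a) (Suc b) =
      A ^ Suc a * Y ^ Suc b
      + (\<Sum>j<b. of_nat ((Suc j + a) choose Suc j) * (A ^ Suc a * B ^ Suc j * Y ^ (b - j)))"
    unfolding pfd_part_def by (subst sum.lessThan_Suc_shift) simp
  also have "\<dots> = A ^ Suc a * Y ^ Suc b
      + (\<Sum>j<b. of_nat ((Suc j + a - 1) choose Suc j) * (A ^ Suc a * B ^ Suc j * Y ^ (b - j)))
      + (\<Sum>j<b. of_nat ((j + a) choose j) * (A ^ Suc a * B ^ Suc j * Y ^ (b - j)))"
    unfolding pascal of_nat_add distrib_right sum.distrib by simp
  also have "A ^ Suc a * Y ^ Suc b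
      + (\<Sum>j<b. of_nat ((Suc j + a - 1) choose Suc j) * (A ^ Suc a * B ^ Suc j * Y ^ (b - j)))
      = A * pfd_part A B Y a (Suc b)"
    unfolding pfd_part_def sum_distrib_left
    by (subst sum.lessThan_Suc_shift) (simp add: mult_ac)
  also have "(\<Sum>j<b. of_nat ((j + a) choose j) * (A ^ Suc a * B ^ Suc j * Y ^ (b - j)))
      = B * pfd_part A B Y (Suc a) b"
    unfolding pfd_part_def sum_distrib_left by (simp add: mult_ac)
  finally show ?thesis .
qed

text \<open>Each replacement lowers the total degree by one, so induction on \<open>a + b\<close>
  ends at pure powers. Degree 0 is excluded: there the monomial is 1 but both parts are empty
  sums.\<close>

lemma power_mult_power_partial_fractions:
  fixes X Y A B :: "'a::comm_ring_1"
  assumes XY: "X * Y = A * Y + B * X" and "a + b > 0"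
  shows "X ^ a * Y ^ b = pfd_part A B Y a b + pfd_part B A X b a"
  using \<open>a + b > 0\<close>
proof (induction "a + b" arbitrary: a b rule: less_induct)
  case less
  consider "a = 0" | "b = 0" | a' b' where "a = Suc a'" "b = Suc b'"
    by (metis not0_implies_Suc)
  thus ?case
  proof cases
    case (3 a' b')
    have "X ^ a * Y ^ b = (X * Y) * (X ^ a' * Y ^ b')"
      by (simp add: 3 mult_ac)
    also have "\<dots> = A * (X ^ a' * Y ^ b) + B * (X ^ a * Y ^ b')"
      by (simp add: XY 3 algebra_simps)
    also have "X ^ a' * Y ^ b = pfd_part A B Y a' b + pfd_part B A X b a'"
      by (rule less.hyps) (simp_all add: 3)
    also have "X ^ a * Y ^ b' = pfd_part A B Y a b' + pfd_part B A X b' a"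
      by (rule less.hyps) (simp_all add: 3)
    finally show ?thesis
      by (simp add: 3 pfd_part_Suc_Suc algebra_simps)
  qed (use less.prems in \<open>simp_all add: pfd_part_0_left\<close>)
qed

section \<open>Powers of geometric series\<close>

abbreviation fps_geometric :: "'a::field_char_0 \<Rightarrow> 'a fps" where
  "fps_geometric c \<equiv> inverse (1 - fps_const c * fps_X)"

text \<open>Supplies the relation \<open>X * Y = A * Y + B * X\<close> with A = y / (y - x) and B =
  x / (x - y). After clearing denominators it reads A (1 - x X) + B (1 - y X) = 1, that is, A + B =
  1 and A x + B y = 0.\<close>

lemma fps_geometric_mult:
  fixes x y :: "'a::field_char_0"
  assumes "x \<noteq> y"
  shows "fps_geometric x * fps_geometric y =
    fps_const (y / (y - x)) * fps_geometric y + fps_const (x / (x - y)) * fps_geometric x"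
proof -
  let ?p = "1 - fps_const x * fps_X" and ?q = "1 - fps_const y * fps_X"
  have inv: "inverse ?p * ?p = 1" "inverse ?q * ?q = 1"
    by (simp_all add: inverse_mult_eq_1)
  have "x / (x - y) = - (x / (y - x))"
    by (simp add: minus_divide_right)
  hence "y / (y - x) + x / (x - y) = 1" "y / (y - x) * x + x / (x - y) * y = 0"
    using assms by (simp_all flip: diff_divide_distrib)
  hence *: "fps_const (y / (y - x)) + fps_const (x / (x - y)) = 1"
    "fps_const (y / (y - x)) * fps_const x + fps_const (x / (x - y)) * fps_const y = 0"
    by simp_all
  have "fps_const (y / (y - x)) * ?p + fps_const (x / (x - y)) * ?q =
      (fps_const (y / (y - x)) + fps_const (x / (x - y)))
      - (fps_const (y / (y - x)) * fps_const x + fps_const (x / (x - y)) * fps_const y) * fps_X"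
    by (simp only: algebra_simps mult_1_left mult_1_right)
  hence one: "fps_const (y / (y - x)) * ?p + fps_const (x / (x - y)) * ?q = 1"
    unfolding * by simp
  have "inverse ?p * inverse ?q =
      inverse ?p * inverse ?q * (fps_const (y / (y - x)) * ?p + fps_const (x / (x - y)) * ?q)"
    unfolding one by simp
  also have "\<dots> = fps_const (y / (y - x)) * inverse ?q * (inverse ?p * ?p)
      + fps_const (x / (x - y)) * inverse ?p * (inverse ?q * ?q)"
    by (simp only: distrib_left mult_ac)
  finally show ?thesis unfolding inv by simp
qed

text \<open>Brings the negative binomial coefficients into the Pochhammer form used in
  \<open>ext_2F1\<close> and \<open>ext_F1\<close>.\<close>

lemma fps_geometric_power_nth:
  "fps_geometric c ^ Suc m $ k = pochhammer (of_nat m + 1) k / fact k * c ^ k"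
proof -
  have "fps_geometric c ^ Suc m $ k = of_nat ((m + k) choose k) * c ^ k"
    using one_minus_const_fps_X_neg_power'[of "Suc m" c] by (simp add: fps_inverse_power del: power_Suc)
  also have "of_nat ((m + k) choose k) = (of_nat (m + k) :: 'a) gchoose k"
    by (rule binomial_gbinomial)
  finally show ?thesis by (simp add: gbinomial_pochhammer')
qed

lemma summable_norm_fps_geometric_power:
  fixes c :: complex
  assumes "norm c < 1"
  shows "summable (\<lambda>k. norm (fps_geometric c ^ Suc m $ k))"
proof -
  \<comment> \<open>The coefficient in question is the term
    \<open>(?a gchoose k) * (- c) ^ k\<close> of a binomial series: the two alternating signs
    cancel.\<close>
  let ?a = "- (of_nat m + 1) :: complex"
  have "ereal (norm (- c)) < conv_radius (\<lambda>k. ?a gchoose k)"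
    using assms by (auto simp: conv_radius_gchoose)
  from abs_summable_in_conv_radius[OF this] show ?thesis
    unfolding fps_geometric_power_nth gbinomial_pochhammer
    by (simp add: norm_mult norm_divide norm_power add.commute)
qed

text \<open>The weight is constant on each antidiagonal m + n = N, where the terms add up to a
  Cauchy product coefficient. Boundedness of \<mu> makes the double family absolutely summable,
  which permits this grouping.\<close>

lemma fps_mult_weighted_sums:
  fixes F G :: "complex fps" and \<mu> :: "nat \<Rightarrow> complex"
  assumes F: "summable (\<lambda>k. norm (F $ k))" and G: "summable (\<lambda>k. norm (G $ k))"
    and \<mu>: "\<And>N. norm (\<mu> N) \<le> C"
  shows "(\<lambda>N. \<mu> N * (F * G) $ N) sums (\<Sum>\<^sub>\<infinity>(m, n)\<in>UNIV. F $ m * G $ n * \<mu> (m + n))"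
proof -
  define f where "f = (\<lambda>(m, n). F $ m * G $ n * \<mu> (m + n))"
  have FG: "(\<lambda>k. norm (F $ k)) summable_on UNIV" "(\<lambda>k. norm (G $ k)) summable_on UNIV"
    using F G norm_summable_imp_summable_on[of "\<lambda>k. norm (F $ k)"]
      norm_summable_imp_summable_on[of "\<lambda>k. norm (G $ k)"] by simp_all
  have "(\<lambda>p. norm (case p of (m, n) \<Rightarrow> F $ m * G $ n)) summable_on UNIV \<times> UNIV"
    unfolding Infinite_Sum.abs_summable_on_Sigma_iff
    using FG by (auto simp: norm_mult infsum_cmult_right' abs_mult
        intro!: summable_on_cmult_left summable_on_cmult_right infsum_nonneg)
  hence "(\<lambda>p. C * norm (case p of (m, n) \<Rightarrow> F $ m * G $ n)) summable_on UNIV"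
    by (intro summable_on_cmult_right) simp
  hence "(\<lambda>p. norm (f p)) summable_on UNIV"
    by (rule Infinite_Sum.abs_summable_on_comparison_test')
      (auto simp: f_def norm_mult mult.commute[of C] intro!: mult_left_mono \<mu>)
  hence f: "f summable_on UNIV" by (rule abs_summable_summable)
  \<comment> \<open>Antidiagonal N, position m; on the index set m \<le> N, so the subtraction is
    not truncated.\<close>
  define h where "h = (\<lambda>(N, m). (m, N - m :: nat))"
  have h: "bij_betw h (SIGMA N:UNIV. {..N}) UNIV"
    by (rule bij_betwI[where g = "\<lambda>(m, n). (m + n, m)"]) (auto simp: h_def)
  have "((\<lambda>p. f (h p)) has_sum infsum f UNIV) (SIGMA N:UNIV. {..N})"
    using has_sum_infsum[OF f] has_sum_reindex_bij_betw[OF h] by blast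
  moreover have "((\<lambda>m. f (h (N, m))) has_sum (\<mu> N * (F * G) $ N)) {..N}" for N
  proof -
    have "(\<Sum>m\<le>N. f (h (N, m))) = \<mu> N * (F * G) $ N"
      by (simp add: f_def h_def fps_mult_nth atLeast0AtMost sum_distrib_left mult_ac)
    thus ?thesis using has_sum_finite[of "{..N}" "\<lambda>m. f (h (N, m))"] by simp
  qed
  ultimately have "((\<lambda>N. \<mu> N * (F * G) $ N) has_sum infsum f UNIV) UNIV"
    by (rule has_sum_SigmaD)
  thus ?thesis unfolding f_def by (rule has_sum_imp_sums)
qed

section \<open>Moments of the extended beta integral\<close>

definition ext_moment ::
  "(complex \<Rightarrow> complex) \<Rightarrow> complex \<Rightarrow> complex \<Rightarrow> nat \<Rightarrow> complex" where
  "ext_moment \<Theta> b d N = ext_beta \<Theta> b d (1 + of_nat N) 1"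

text \<open>The N-th integrand is u ^ N times the one for N = 0, and |u ^ N| \<le> 1 on (0, 1);
  hence a bound independent of N.\<close>

lemma (in ext_kernel) norm_ext_moment_le:
  assumes "Re b \<ge> 0" "Re d \<ge> 0"
  shows "norm (ext_moment \<Theta> b d N) \<le> (LINT u:{0<..<1}|lborel. norm (ext_beta_integrand \<Theta> b d 1 1 u))"
proof -
  have int: "set_integrable lborel {0<..<1} (ext_beta_integrand \<Theta> b d (1 + of_nat n) 1)" for n
    using assms by (intro integrable) (auto intro: add_pos_nonneg)
  have "norm (ext_moment \<Theta> b d N) \<le>
      (LINT u:{0<..<1}|lborel. norm (ext_beta_integrand \<Theta> b d (1 + of_nat N) 1 u))"
    unfolding ext_moment_def ext_beta_def by (rule set_integral_norm_bound[OF int])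
  also have "\<dots> \<le> (LINT u:{0<..<1}|lborel. norm (ext_beta_integrand \<Theta> b d 1 1 u))"
  proof (rule set_integral_mono)
    fix u :: real assume u: "u \<in> {0<..<1}"
    have "norm (of_real u powr (of_nat N :: complex)) = u ^ N"
      using u by (simp add: norm_powr_real_powr powr_realpow norm_power)
    also have "\<dots> \<le> 1" using u by (simp add: power_le_one)
    finally show "norm (ext_beta_integrand \<Theta> b d (1 + of_nat N) 1 u)
        \<le> norm (ext_beta_integrand \<Theta> b d 1 1 u)"
      using u unfolding ext_beta_integrand_def
      by (simp add: norm_mult mult_left_le_one_le)
  qed (use int[of N] int[of 0] in \<open>auto intro: set_integrable_norm\<close>)
  finally show ?thesis .
qed

lemma Beta_1_1 [simp]: "Beta 1 1 = (1 :: complex)"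
  using Gamma_fact[of 1, where ?'a = complex] by (simp add: Beta_def)

section \<open>The extended functions as moment sums\<close>

lemma ext_2F1_sums:
  assumes "norm z < 1" and \<mu>: "\<And>N. norm (ext_moment \<Theta> b d N) \<le> C"
  shows "(\<lambda>N. ext_moment \<Theta> b d N * fps_geometric z ^ Suc m $ N)
    sums ext_2F1 \<Theta> (of_nat m + 1) 1 2 z b d"
proof -
  have "summable (\<lambda>N. ext_moment \<Theta> b d N * fps_geometric z ^ Suc m $ N)"
  proof (rule summable_comparison_test')
    show "summable (\<lambda>N. C * norm (fps_geometric z ^ Suc m $ N))"
      by (intro summable_mult summable_norm_fps_geometric_power assms)
  qed (auto simp: norm_mult intro!: mult_right_mono \<mu>)
  moreover have "ext_2F1 \<Theta> (of_nat m + 1) 1 2 z b d =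
      (\<Sum>N. ext_moment \<Theta> b d N * fps_geometric z ^ Suc m $ N)"
    unfolding ext_2F1_def fps_geometric_power_nth ext_moment_def by (simp add: mult_ac)
  ultimately show ?thesis by (simp add: summable_sums)
qed

lemma ext_F1_sums:
  assumes "norm x < 1" "norm y < 1" and \<mu>: "\<And>N. norm (ext_moment \<Theta> b d N) \<le> C"
  shows "(\<lambda>N. ext_moment \<Theta> b d N * (fps_geometric x ^ Suc s * fps_geometric y ^ Suc t) $ N)
    sums ext_F1 \<Theta> 1 (of_nat s + 1) (of_nat t + 1) 2 x y b d"
proof -
  have "ext_F1 \<Theta> 1 (of_nat s + 1) (of_nat t + 1) 2 x y b d =
    (\<Sum>\<^sub>\<infinity>(m, n)\<in>UNIV. fps_geometric x ^ Suc s $ m * fps_geometric y ^ Suc t $ n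
        * ext_moment \<Theta> b d (m + n))"
    unfolding ext_F1_def fps_geometric_power_nth ext_moment_def
    by (simp add: mult_ac add_ac)
  thus ?thesis
    using fps_mult_weighted_sums[OF summable_norm_fps_geometric_power
        summable_norm_fps_geometric_power \<mu>] assms by simp
qed

lemma pfd_part_sums:
  assumes "norm y < 1" and \<mu>: "\<And>N. norm (ext_moment \<Theta> b d N) \<le> C"
  shows "(\<lambda>N. ext_moment \<Theta> b d N
        * pfd_part (fps_const A) (fps_const B) (fps_geometric y) (Suc s) (Suc t) $ N)
    sums (\<Sum>j<Suc t. of_nat ((j + s) choose s) * (A ^ Suc s * B ^ j)
        * ext_2F1 \<Theta> (of_nat t - of_nat j + 1) 1 2 y b d)"
proof -
  have "(\<lambda>N. \<Sum>j<Suc t. of_nat ((j + s) choose s) * (A ^ Suc s * B ^ j)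
          * (ext_moment \<Theta> b d N * fps_geometric y ^ Suc (t - j) $ N))
    sums (\<Sum>j<Suc t. of_nat ((j + s) choose s) * (A ^ Suc s * B ^ j)
        * ext_2F1 \<Theta> (of_nat (t - j) + 1) 1 2 y b d)"
    by (intro sums_sum sums_mult ext_2F1_sums[OF assms])
  moreover have "(\<Sum>j<Suc t. of_nat ((j + s) choose s) * (A ^ Suc s * B ^ j)
          * (ext_moment \<Theta> b d N * fps_geometric y ^ Suc (t - j) $ N)) =
      ext_moment \<Theta> b d N
        * pfd_part (fps_const A) (fps_const B) (fps_geometric y) (Suc s) (Suc t) $ N" for N
  proof -
    have coeff: "(of_nat ((j + Suc s - 1) choose j) * (fps_const A ^ Suc s * fps_const B ^ j
            * fps_geometric y ^ (Suc t - j))) $ N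
        = of_nat ((j + s) choose s) * (A ^ Suc s * B ^ j) * fps_geometric y ^ Suc (t - j) $ N"
      if "j < Suc t" for j
    proof -
      \<comment> \<open>Symmetry of the binomial coefficient passes to the lower index
        \<open>s\<close> used in the theorem.\<close>
      have "(j + Suc s - 1) choose j = (j + s) choose s"
        by (simp add: binomial_symmetric[of j "j + s"])
      moreover have "Suc t - j = Suc (t - j)" using that by simp
      moreover have "of_nat ((j + s) choose s) * (fps_const A ^ Suc s * fps_const B ^ j * H)
          = fps_const (of_nat ((j + s) choose s) * (A ^ Suc s * B ^ j)) * H" for H
        by (simp add: fps_of_nat[symmetric] fps_const_power mult.assoc[symmetric]
            del: power_Suc fps_of_nat)
      ultimately show ?thesis by (simp only: fps_mult_left_const_nth)
    qed
    thus ?thesis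
      unfolding pfd_part_def fps_sum_nth sum_distrib_left
      by (intro sum.cong refl, simp only: lessThan_iff coeff) (simp only: mult_ac)
  qed
  \<comment> \<open>Since j \<le> t, the truncated difference \<open>t - j\<close> agrees with the
    complex one.\<close>
  ultimately show ?thesis by (simp add: of_nat_diff del: sum.lessThan_Suc)
qed

theorem theorem3p7:
  fixes \<kappa> :: "nat \<Rightarrow> complex" and \<Theta> :: "complex \<Rightarrow> complex"
    and R M\<^sub>0 :: real and \<omega> :: complex
    and s t :: nat and x y b d :: complex
  assumes "ext_kernel \<kappa> R \<Theta> M\<^sub>0 \<omega>"
    and "norm x < 1" and "norm y < 1" and "x \<noteq> y"
    and "min (Re b) (Re d) \<ge> 0"
  shows "ext_F1 \<Theta> 1 (of_nat s + 1) (of_nat t + 1) 2 x y b d =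
      y ^ (s + 1) * (\<Sum>j<t. of_nat ((j + s) choose s) * ((- x) ^ j / (y - x) ^ (j + s + 1))
                             * ext_2F1 \<Theta> (of_nat t - of_nat j + 1) 1 2 y b d)
    + x ^ (t + 1) * (\<Sum>k<s. of_nat ((k + t) choose t) * ((- y) ^ k / (x - y) ^ (k + t + 1))
                             * ext_2F1 \<Theta> (of_nat s - of_nat k + 1) 1 2 x b d)
    + of_nat ((t + s) choose s) * ((- 1) ^ t * x ^ t * y ^ s / (y - x) ^ (t + s + 1))
        * (y * ext_2F1 \<Theta> 1 1 2 y b d - x * ext_2F1 \<Theta> 1 1 2 x b d)"
proof -
  interpret ext_kernel \<kappa> R \<Theta> M\<^sub>0 \<omega> by fact
  let ?C = "LINT u:{0<..<1}|lborel. norm (ext_beta_integrand \<Theta> b d 1 1 u)"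
  let ?g = "\<lambda>m z. ext_2F1 \<Theta> m 1 2 z b d"
  define A where "A = y / (y - x)"
  define B where "B = x / (x - y)"
  have \<mu>: "norm (ext_moment \<Theta> b d N) \<le> ?C" for N
    using assms(5) by (intro norm_ext_moment_le) auto
  have pfd: "fps_geometric x ^ Suc s * fps_geometric y ^ Suc t =
      pfd_part (fps_const A) (fps_const B) (fps_geometric y) (Suc s) (Suc t)
      + pfd_part (fps_const B) (fps_const A) (fps_geometric x) (Suc t) (Suc s)"
    unfolding A_def B_def
    by (rule power_mult_power_partial_fractions[OF fps_geometric_mult[OF \<open>x \<noteq> y\<close>]]) simp
  \<comment> \<open>One series has both values as its sum. The last terms, j = t and k = s, have
    first parameter 1 and will form the bracket.\<close>
  have *: "ext_F1 \<Theta> 1 (of_nat s + 1) (of_nat t + 1) 2 x y b d =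
      (\<Sum>j<Suc t. of_nat ((j + s) choose s) * (A ^ Suc s * B ^ j) * ?g (of_nat t - of_nat j + 1) y)
      + (\<Sum>k<Suc s. of_nat ((k + t) choose t) * (B ^ Suc t * A ^ k) * ?g (of_nat s - of_nat k + 1) x)"
    using ext_F1_sums[OF assms(2,3) \<mu>, of s t]
      sums_add[OF pfd_part_sums[OF assms(3) \<mu>, of A B s t] pfd_part_sums[OF assms(2) \<mu>, of B A t s]]
    unfolding pfd fps_add_nth distrib_left by (rule sums_unique2)
  \<comment> \<open>Both constants are needed over either denominator: y - x for the sum in y, x - y
    for the sum in x.\<close>
  have A: "A = - y / (x - y)" and B: "B = - x / (y - x)"
    unfolding A_def B_def by (simp_all add: minus_divide_right)
  have AB: "A ^ Suc s * B ^ j = y ^ (s + 1) * ((- x) ^ j / (y - x) ^ (j + s + 1))" for j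
    unfolding A_def B power_divide power_add by (simp add: mult_ac)
  have BA: "B ^ Suc t * A ^ k = x ^ (t + 1) * ((- y) ^ k / (x - y) ^ (k + t + 1))" for k
    unfolding A B_def power_divide power_add by (simp add: mult_ac)
  have sign: "(- z) ^ n = (- 1) ^ n * z ^ n" for z :: complex and n
    by (rule power_minus)
  have last_y: "A ^ Suc s * B ^ t = (- 1) ^ t * x ^ t * y ^ s / (y - x) ^ (t + s + 1) * y"
    unfolding AB by (simp add: sign[of x] mult_ac)
  \<comment> \<open>Over the common denominator y - x, \<open>B\<close> contributes one more factor
    -1 than in \<open>last_y\<close>, which explains the minus sign in the bracket.\<close>
  have last_x: "B ^ Suc t * A ^ s = - ((- 1) ^ t * x ^ t * y ^ s / (y - x) ^ (t + s + 1) * x)"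
    unfolding A_def B power_divide power_add sign[of x] power_Suc by (simp add: mult_ac)
  show ?thesis
    unfolding * sum.lessThan_Suc last_y last_x unfolding AB BA
    by (simp add: sum_distrib_left mult_ac add.commute[of s t] binomial_symmetric[of s "t + s"]
        right_diff_distrib diff_divide_distrib)
qed

end
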